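(* Let $r\geq 2$. Then there exists $k_0$ such that for all $k\geq k_0$, $\mathrm{bal}_r(n,P_{2rk})=o(n^2)$ as $n\to\infty$.
   Context: $P_m$ denotes the path with $m$ edges. An $r$-edge-colored graph $G$ is balanced if each of the $r$ colors appears on either $\lfloor e(G)/r\rfloor$ or $\lceil e(G)/r\rceil$ edges. For a graph $G$, $\mathrm{bal}_r(n,G)$ is the minimum integer $m$ (if it exists) such that every $r$-edge-coloring of $K_n$ with more than $m$ edges in each of the $r$ colors contains a balanced copy of $G$ (a subgraph isomorphic to $G$ whose inherited coloring is balanced); if no such $m$ exists, $\mathrm{bal}_r(n,G)=\infty$. *)

theory Defs
  imports Complex_Main "HOL-Library.Extended_Nat" "HOL-Library.Landau_Symbols"
begin

text \<open>A graph is a pair of a vertex set and a set of edges, an edge being a two-element set of vertices.\<close>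

type_synonym 'a graph = "'a set \<times> 'a set set"

abbreviation verts :: "'a graph \<Rightarrow> 'a set" where
  "verts G \<equiv> fst G"

abbreviation edges :: "'a graph \<Rightarrow> 'a set set" where
  "edges G \<equiv> snd G"

definition simple_graph :: "'a graph \<Rightarrow> bool" where
  "simple_graph G \<longleftrightarrow> (\<forall>e\<in>edges G. e \<subseteq> verts G \<and> card e = 2)"

definition subgraph :: "'a graph \<Rightarrow> 'a graph \<Rightarrow> bool" where
  "subgraph H G \<longleftrightarrow> simple_graph H \<and> verts H \<subseteq> verts G \<and> edges H \<subseteq> edges G"

definition isomorphic :: "'a graph \<Rightarrow> 'b graph \<Rightarrow> bool" where
  "isomorphic G H \<longleftrightarrow>
     (\<exists>f. bij_betw f (verts G) (verts H) \<and>
          (\<forall>u\<in>verts G. \<forall>v\<in>verts G. {u, v} \<in> edges G \<longleftrightarrow> {f u, f v} \<in> edges H))"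

definition complete_graph :: "nat \<Rightarrow> nat graph" where
  "complete_graph n = ({..<n}, {e. e \<subseteq> {..<n} \<and> card e = 2})"

text \<open>The parameter of the path is its number of edges; the path has one more vertex.\<close>

definition path_graph :: "nat \<Rightarrow> nat graph" where
  "path_graph m = ({..m}, {{i, Suc i} | i. i < m})"

definition edge_coloring :: "nat \<Rightarrow> 'a graph \<Rightarrow> ('a set \<Rightarrow> nat) \<Rightarrow> bool" where
  "edge_coloring r G c \<longleftrightarrow> (\<forall>e\<in>edges G. c e < r)"

definition color_class :: "'a graph \<Rightarrow> ('a set \<Rightarrow> nat) \<Rightarrow> nat \<Rightarrow> 'a set set" where
  "color_class G c i = {e \<in> edges G. c e = i}"

definition balanced :: "nat \<Rightarrow> 'a graph \<Rightarrow> ('a set \<Rightarrow> nat) \<Rightarrow> bool" where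
  "balanced r G c \<longleftrightarrow>
     (\<forall>i<r. int (card (color_class G c i)) = \<lfloor>real (card (edges G)) / real r\<rfloor> \<or>
            int (card (color_class G c i)) = \<lceil>real (card (edges G)) / real r\<rceil>)"

definition contains_balanced_copy ::
  "nat \<Rightarrow> 'b graph \<Rightarrow> ('b set \<Rightarrow> nat) \<Rightarrow> 'a graph \<Rightarrow> bool" where
  "contains_balanced_copy r K c G \<longleftrightarrow>
     (\<exists>H. subgraph H K \<and> isomorphic G H \<and> balanced r H c)"

definition forces_balanced_copy :: "nat \<Rightarrow> nat \<Rightarrow> 'a graph \<Rightarrow> nat \<Rightarrow> bool" where
  "forces_balanced_copy r n G m \<longleftrightarrow>
     (\<forall>c. edge_coloring r (complete_graph n) c \<and>
          (\<forall>i<r. card (color_class (complete_graph n) c i) > m) \<longrightarrow>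
          contains_balanced_copy r (complete_graph n) c G)"

text \<open>
  The threshold condition holds vacuously once no coloring of the complete graph has more
  than \<open>m\<close> edges in every color. Such values of \<open>m\<close> are about \<open>n\<^sup>2 / (2 * r)\<close> or larger, so
  a bound of the form \<open>o(n\<^sup>2)\<close> always concerns values for which it is not vacuous.
\<close>

definition bal :: "nat \<Rightarrow> nat \<Rightarrow> 'a graph \<Rightarrow> enat" where
  "bal r n G =
     (if \<exists>m. forces_balanced_copy r n G m
      then enat (LEAST m. forces_balanced_copy r n G m) else \<infinity>)"

end

theory Submission
  imports Defs
begin

text \<open>
  Every color class of size \<open>\<Omega>(n\<^sup>2)\<close> contains a large monochromatic complete bipartite graph,
  and these bicliques can be chosen disjoint for the \<open>r\<close> colors. Fix one of them, with sides
  \<open>A\<close>, \<open>B\<close>, as a hub. For every other color \<open>i\<close>, with sides \<open>A\<^sub>i\<close>, \<open>B\<^sub>i\<close>, the pigeonhole principle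
  yields two disjoint edges of equal color between \<open>A\<close> and \<open>A\<^sub>i\<close>; a detour from the hub into the
  \<open>i\<close>-th biclique and back along these two edges uses every color an even number of times. Since the
  zigzags inside the bicliques have arbitrary even length, all the color counts can be raised
  to exactly \<open>2k\<close>, as soon as \<open>k\<close> exceeds the number of forced pairs of edges of each color.
\<close>

section \<open>Edge sequences of paths\<close>

fun path_edges :: "'a list \<Rightarrow> 'a set list" where
  "path_edges (x # y # zs) = {x, y} # path_edges (y # zs)"
| "path_edges _ = []"

lemma path_edges_Cons:
  "ys \<noteq> [] \<Longrightarrow> path_edges (x # ys) = {x, hd ys} # path_edges ys"
  by (cases ys) auto

lemma path_edges_append:
  "xs \<noteq> [] \<Longrightarrow> ys \<noteq> [] \<Longrightarrow>
    path_edges (xs @ ys) = path_edges xs @ {last xs, hd ys} # path_edges ys"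
  by (induction xs rule: path_edges.induct) (auto simp: path_edges_Cons)

lemma length_path_edges: "length (path_edges xs) = length xs - 1"
  by (induction xs rule: path_edges.induct) auto

lemma nth_path_edges:
  "Suc i < length xs \<Longrightarrow> path_edges xs ! i = {xs ! i, xs ! Suc i}"
  by (induction xs arbitrary: i rule: path_edges.induct) (auto simp: nth_Cons split: nat.splits)

lemma in_path_edges_subset: "e \<in> set (path_edges xs) \<Longrightarrow> e \<subseteq> set xs"
  by (induction xs rule: path_edges.induct) auto

lemma card_in_path_edges: "distinct xs \<Longrightarrow> e \<in> set (path_edges xs) \<Longrightarrow> card e = 2"
  by (induction xs rule: path_edges.induct) auto

lemma distinct_path_edges: "distinct xs \<Longrightarrow> distinct (path_edges xs)"
  by (induction xs rule: path_edges.induct) (auto dest: in_path_edges_subset)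

lemma set_path_edges:
  "set (path_edges xs) = {{xs ! i, xs ! Suc i} | i. Suc i < length xs}"
proof -
  have "i < length (path_edges xs) \<longleftrightarrow> Suc i < length xs" for i
    by (auto simp: length_path_edges)
  then show ?thesis
    by (force simp: set_conv_nth nth_path_edges)
qed

lemma isomorphic_path_graph:
  assumes "distinct xs" "length xs = Suc m"
  shows "isomorphic (path_graph m) (set xs, set (path_edges xs))"
proof -
  have inj: "inj_on ((!) xs) {..m}"
    using assms by (auto simp: inj_on_def nth_eq_iff_index_eq)
  have "bij_betw ((!) xs) {..m} (set xs)"
    using assms by (intro bij_betw_nth) auto
  moreover have "{u, v} \<in> {{i, Suc i} |i. i < m} \<longleftrightarrow> {xs ! u, xs ! v} \<in> set (path_edges xs)"
    if "u \<le> m" "v \<le> m" for u v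
  proof -
    \<comment> \<open>Injectivity of indexing lifts to two-element sets, so an edge of the list
      comes from exactly one pair of positions, whichever orientation \<open>u\<close>,
      \<open>v\<close> have. This gives both directions of the equivalence, in particular that no
      chord arises.\<close>
    have "{xs ! u, xs ! v} = {xs ! i, xs ! Suc i} \<longleftrightarrow> {u, v} = {i, Suc i}" if "i < m" for i
      using inj_on_image_eq_iff[OF inj, of "{u, v}" "{i, Suc i}"] that \<open>u \<le> m\<close> \<open>v \<le> m\<close> by auto
    then show ?thesis
      using assms(2) by (auto simp: set_path_edges)
  qed
  ultimately show ?thesis
    unfolding isomorphic_def path_graph_def by auto
qed

text \<open>Balance reduces to exact counting: \<open>s\<close> edges in each of \<open>r\<close>
  colors make \<open>r * s\<close> edges in all, so floor and ceiling of the average coincide with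
  \<open>s\<close>.\<close>

lemma contains_balanced_copy_path_graph:
  assumes "distinct xs" "set xs \<subseteq> {..<n}" "r > 0"
    and col: "\<And>u v. u < n \<Longrightarrow> v < n \<Longrightarrow> u \<noteq> v \<Longrightarrow> c {u, v} < r"
    and cnt: "\<And>i. i < r \<Longrightarrow> count_list (map c (path_edges xs)) i = s"
    and "xs \<noteq> []"
  shows "contains_balanced_copy r (complete_graph n) c (path_graph (r * s))"
proof -
  let ?es = "path_edges xs" and ?H = "(set xs, set (path_edges xs))"
  have edge: "e \<subseteq> set xs \<and> card e = 2" if "e \<in> set ?es" for e
    using that assms(1) by (simp add: in_path_edges_subset card_in_path_edges)
  have "c e < r" if e: "e \<in> set ?es" for e
  proof -
    obtain u v where "e = {u, v}" "u \<noteq> v"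
      using edge[OF e] by (auto simp: card_2_iff)
    then show ?thesis
      using edge[OF e] assms(2) by (auto intro!: col)
  qed
  then have "length ?es = (\<Sum>i<r. count_list (map c ?es) i)"
    using sum_count_set[of "map c ?es" "{..<r}"] by fastforce
  then have len: "length ?es = r * s"
    using cnt by simp
  have "length xs = Suc (r * s)"
    using len \<open>xs \<noteq> []\<close> by (cases xs) (auto simp: length_path_edges)
  then have "isomorphic (path_graph (r * s)) ?H"
    using assms(1) by (rule isomorphic_path_graph[rotated])
  moreover have "subgraph ?H (complete_graph n)"
    using edge assms(2) unfolding subgraph_def simple_graph_def complete_graph_def by fastforce
  moreover have "balanced r ?H c"
  proof -
    have "card (color_class ?H c i) = s" if "i < r" for i
    proof -
      have "color_class ?H c i = set (filter (\<lambda>e. c e = i) ?es)"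
        by (auto simp: color_class_def)
      also have "card \<dots> = length (filter (\<lambda>e. c e = i) ?es)"
        using assms(1) by (intro distinct_card distinct_filter distinct_path_edges)
      also have "\<dots> = count_list (map c ?es) i"
        by (simp add: count_list_eq_length_filter filter_map o_def eq_commute)
      finally show ?thesis using cnt that by simp
    qed
    moreover have "card (set ?es) = r * s"
      using len assms(1) by (simp add: distinct_card distinct_path_edges)
    ultimately show ?thesis
      using \<open>r > 0\<close> by (simp add: balanced_def)
  qed
  ultimately show ?thesis
    unfolding contains_balanced_copy_def by blast
qed

section \<open>Balanced paths from disjoint monochromatic bicliques\<close>

text \<open>The number \<open>s\<close> only bounds the sides from below, so that the notion
  survives the deletion of used vertices. Disjoint sides keep every \<open>{a, b}\<close> a genuine
  edge.\<close>

definition biclique :: "('a set \<Rightarrow> nat) \<Rightarrow> nat \<Rightarrow> nat \<Rightarrow> 'a set \<Rightarrow> 'a set \<Rightarrow> bool" where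
  "biclique c i s A B \<longleftrightarrow> finite A \<and> finite B \<and> s \<le> card A \<and> s \<le> card B \<and> A \<inter> B = {} \<and>
     (\<forall>a\<in>A. \<forall>b\<in>B. c {a, b} = i)"

lemma biclique_mono: "biclique c i s A B \<Longrightarrow> t \<le> s \<Longrightarrow> biclique c i t A B"
  by (auto simp: biclique_def)

lemma biclique_Diff:
  assumes "biclique c i s A B" "finite X" "finite Y" "t + card X \<le> s" "t + card Y \<le> s"
  shows "biclique c i t (A - X) (B - Y)"
  using assms diff_card_le_card_Diff[of X A] diff_card_le_card_Diff[of Y B]
  by (auto simp: biclique_def)

text \<open>A path alternating between the sides visits \<open>m + 1\<close> vertices of
  \<open>A\<close> and \<open>m\<close> of \<open>B\<close>, which explains the size
  \<open>Suc m\<close>. The induction prepends two edges \<open>u\<close>, \<open>b\<close>,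
  \<open>w\<close> and deletes \<open>u\<close> and \<open>b\<close> from the biclique.\<close>

lemma biclique_zigzag:
  assumes "biclique c i (Suc m) A B" "m \<ge> 1" "u \<in> A" "v \<in> A" "u \<noteq> v"
  shows "\<exists>zs. zs \<noteq> [] \<and> hd zs = u \<and> last zs = v \<and> distinct zs \<and> set zs \<subseteq> A \<union> B \<and>
           map c (path_edges zs) = replicate (2 * m) i"
  using assms(2,1,3-)
proof (induction m arbitrary: A B u rule: nat_induct_at_least)
  case base
  then have "card B \<noteq> 0" by (auto simp: biclique_def)
  then obtain b where "b \<in> B" by fastforce
  then show ?case
    using base by (intro exI[of _ "[u, b, v]"]) (auto simp: biclique_def numeral_2_eq_2 insert_commute)
next
  case (Suc m)
  then have "card B \<noteq> 0" by (auto simp: biclique_def)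
  then obtain b where b: "b \<in> B" by fastforce
  \<comment> \<open>Here \<open>A\<close> has at least \<open>m + 2\<close>, hence at least three,
    elements, so an intermediate vertex \<open>w\<close> other than both ends exists.\<close>
  have "card {u, v} < card A"
    using Suc by (auto simp: biclique_def card_insert_if)
  then obtain w where w: "w \<in> A" "w \<noteq> u" "w \<noteq> v"
    by (metis card_mono finite.emptyI finite_insert insertCI leD subsetI)
  have "biclique c i (Suc m) (A - {u}) (B - {b})"
    using Suc.prems(1) by (rule biclique_Diff) auto
  from Suc.IH[OF this, of w] w Suc.prems obtain zs where zs: "zs \<noteq> []" "hd zs = w" "last zs = v"
    "distinct zs" "set zs \<subseteq> (A - {u}) \<union> (B - {b})" "map c (path_edges zs) = replicate (2 * m) i"
    by auto
  have "c {u, b} = i" "c {b, w} = i" "u \<notin> B" "b \<notin> A"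
    using Suc.prems b w by (auto simp: biclique_def insert_commute)
  then show ?case
    using zs b Suc.prems
    by (intro exI[of _ "u # b # zs"]) (auto simp: path_edges_Cons)
qed

text \<open>A bijection between subsets of size \<open>r + 1\<close> is a matching with more edges
  than there are colors, so two of its edges share a color.\<close>

lemma equal_colored_disjoint_pairs:
  fixes f :: "'a \<Rightarrow> 'b \<Rightarrow> nat"
  assumes "finite A" "finite B" "r < card A" "r < card B"
    and "\<And>a b. a \<in> A \<Longrightarrow> b \<in> B \<Longrightarrow> f a b < r"
  obtains x x' y y' where "x \<in> A" "x' \<in> A" "x \<noteq> x'" "y \<in> B" "y' \<in> B" "y \<noteq> y'" "f x y = f x' y'"
proof -
  obtain A' where A': "A' \<subseteq> A" "card A' = Suc r"
    using assms(3) by (meson Suc_leI obtain_subset_with_card_n)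
  obtain B' where B': "B' \<subseteq> B" "card B' = Suc r"
    using assms(4) by (meson Suc_leI obtain_subset_with_card_n)
  obtain g where g: "bij_betw g A' B'"
    using A' B' assms(1,2) by (metis finite_same_card_bij finite_subset)
  have "(\<lambda>a. f a (g a)) ` A' \<subseteq> {..<r}"
    using A' B' g by (auto simp: bij_betw_def intro!: assms(5))
  then have "card ((\<lambda>a. f a (g a)) ` A') \<le> card {..<r}"
    by (rule card_mono[rotated]) simp
  then have "card ((\<lambda>a. f a (g a)) ` A') < card A'"
    using A'(2) by simp
  then obtain x x' where "x \<in> A'" "x' \<in> A'" "x \<noteq> x'" "f x (g x) = f x' (g x')"
    using pigeonhole unfolding inj_on_def by blast
  with g A' B' that[of x x' "g x" "g x'"] show thesis
    by (auto simp: bij_betw_def inj_on_def)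
qed

text \<open>
  The number \<open>e j\<close> counts the detours whose two connecting edges have color \<open>j\<close>; it does not
  depend on the lengths \<open>2 * m i\<close> of the zigzags, which can therefore be chosen in terms of \<open>e\<close>.
\<close>

lemma hub_path:
  assumes "finite I" "h \<notin> I"
    and "biclique c h (2 * card I + Suc (r + k)) A B"
    and "\<forall>i\<in>I. biclique c i (Suc (r + k)) (P i) (Q i)"
    and "\<forall>i\<in>I. (P i \<union> Q i) \<inter> (A \<union> B) = {}"
    and "\<forall>i\<in>I. \<forall>j\<in>I. i \<noteq> j \<longrightarrow> (P i \<union> Q i) \<inter> (P j \<union> Q j) = {}"
    and "\<forall>i\<in>I. \<forall>x\<in>A. \<forall>y\<in>P i. c {x, y} < r"
  shows "\<exists>e. (\<forall>j. e j \<le> card I) \<and>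
    (\<forall>m. (\<forall>j. 1 \<le> m j \<and> m j \<le> k) \<longrightarrow>
      (\<exists>xs. xs \<noteq> [] \<and> distinct xs \<and> hd xs \<in> A \<and> set xs \<subseteq> A \<union> B \<union> (\<Union>i\<in>I. P i \<union> Q i) \<and>
        (\<forall>j. count_list (map c (path_edges xs)) j =
          2 * (e j + (if j \<in> insert h I then m j else 0) + (if j = h then card I else 0)))))"
  using assms
proof (induction I arbitrary: A B rule: finite_induct)
  case empty
  \<comment> \<open>Without detours the path is a single zigzag in the hub. Its start in
    \<open>A\<close> is the invariant that allows detours to be prepended.\<close>
  have "\<exists>xs. xs \<noteq> [] \<and> distinct xs \<and> hd xs \<in> A \<and>
        set xs \<subseteq> A \<union> B \<union> (\<Union>i\<in>{}. P i \<union> Q i) \<and>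
        (\<forall>j. count_list (map c (path_edges xs)) j =
          2 * (0 + (if j \<in> {h} then m j else 0) + (if j = h then card {} else 0)))"
    if "\<forall>j. 1 \<le> m j \<and> m j \<le> k" for m
  proof -
    have k: "1 \<le> m h" "m h \<le> k" using that by auto
    have "\<not> card A \<le> Suc 0" "finite A"
      using empty.prems(2) k by (auto simp: biclique_def)
    then obtain u v where uv: "u \<in> A" "v \<in> A" "u \<noteq> v"
      by (metis One_nat_def card_le_Suc0_iff_eq)
    have "biclique c h (Suc (m h)) A B"
      using empty.prems(2) by (rule biclique_mono) (use k in simp)
    from biclique_zigzag[OF this k(1) uv] obtain zs where "zs \<noteq> []" "hd zs = u" "distinct zs"
      "set zs \<subseteq> A \<union> B" "map c (path_edges zs) = replicate (2 * m h) h"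
      by blast
    then show ?thesis
      using uv(1) by (intro exI[of _ zs]) (auto simp: count_list_eq_length_filter)
  qed
  then show ?case
    by (intro exI[of _ "\<lambda>_. 0"]) blast
next
  case (insert i I)
  have bi: "biclique c i (Suc (r + k)) (P i) (Q i)" and "h \<noteq> i" "h \<notin> I"
    using insert.prems by auto
  note hub = insert.prems(2)
  \<comment> \<open>The size \<open>Suc (r + k)\<close> serves twice: it exceeds \<open>r\<close>
    for the pigeonhole principle, and it leaves room for a zigzag with \<open>m i\<close> at most
    \<open>k\<close>.\<close>
  have "finite A" "finite (P i)" "r < card A" "r < card (P i)"
    using bi hub by (auto simp: biclique_def)
  then obtain x x' y y' where x: "x \<in> A" "x' \<in> A" "x \<noteq> x'" and y: "y \<in> P i" "y' \<in> P i" "y \<noteq> y'"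
    and eq: "c {x, y} = c {x', y'}"
    by (rule equal_colored_disjoint_pairs[of A "P i" r "\<lambda>x y. c {x, y}"]) (use insert.prems(6) in auto)
  have "card B \<noteq> 0"
    using hub by (auto simp: biclique_def)
  then obtain b where b: "b \<in> B" by fastforce
  \<comment> \<open>A detour consumes two vertices of \<open>A\<close> and one of \<open>B\<close>;
    the summand \<open>2 * card I\<close> in the size of the hub pays for this.\<close>
  have hub': "biclique c h (2 * card I + Suc (r + k)) (A - {x, x'}) (B - {b})"
    using hub by (rule biclique_Diff) (use insert.hyps x in auto)
  have bi': "\<forall>j\<in>I. biclique c j (Suc (r + k)) (P j) (Q j)"
    and disj_hub': "\<forall>j\<in>I. (P j \<union> Q j) \<inter> (A - {x, x'} \<union> (B - {b})) = {}"
    and disj': "\<forall>j\<in>I. \<forall>l\<in>I. j \<noteq> l \<longrightarrow> (P j \<union> Q j) \<inter> (P l \<union> Q l) = {}"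
    and col': "\<forall>j\<in>I. \<forall>u\<in>A - {x, x'}. \<forall>v\<in>P j. c {u, v} < r"
    using insert.prems(3-6) by blast+
  obtain e where e: "\<And>j. e j \<le> card I"
    and path: "\<And>m. \<forall>j. 1 \<le> m j \<and> m j \<le> k \<Longrightarrow>
      \<exists>xs. xs \<noteq> [] \<and> distinct xs \<and> hd xs \<in> A - {x, x'} \<and>
        set xs \<subseteq> A - {x, x'} \<union> (B - {b}) \<union> (\<Union>i\<in>I. P i \<union> Q i) \<and>
        (\<forall>j. count_list (map c (path_edges xs)) j =
          2 * (e j + (if j \<in> insert h I then m j else 0) + (if j = h then card I else 0)))"
    using insert.IH[OF \<open>h \<notin> I\<close> hub' bi' disj_hub' disj' col'] by blast
  \<comment> \<open>The connecting edges are fixed before \<open>m\<close> is given. Being two of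
    one color, they raise that color's halved count by one.\<close>
  define e' where "e' = e(c {x, y} := Suc (e (c {x, y})))"
  have "\<exists>xs. xs \<noteq> [] \<and> distinct xs \<and> hd xs \<in> A \<and>
        set xs \<subseteq> A \<union> B \<union> (\<Union>i\<in>insert i I. P i \<union> Q i) \<and>
        (\<forall>j. count_list (map c (path_edges xs)) j =
          2 * (e' j + (if j \<in> insert h (insert i I) then m j else 0)
            + (if j = h then card (insert i I) else 0)))"
    if m: "\<forall>j. 1 \<le> m j \<and> m j \<le> k" for m
  proof -
    obtain xs where xs: "xs \<noteq> []" "distinct xs" "hd xs \<in> A - {x, x'}"
      "set xs \<subseteq> A - {x, x'} \<union> (B - {b}) \<union> (\<Union>i\<in>I. P i \<union> Q i)"
      and cnt: "\<And>j. count_list (map c (path_edges xs)) j =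
          2 * (e j + (if j \<in> insert h I then m j else 0) + (if j = h then card I else 0))"
      using path[OF m] by blast
    have "biclique c i (Suc (m i)) (P i) (Q i)"
      using bi by (rule biclique_mono) (use m in \<open>simp add: trans_le_add2\<close>)
    from biclique_zigzag[OF this _ y] m obtain zs where zs: "zs \<noteq> []" "hd zs = y" "last zs = y'"
      "distinct zs" "set zs \<subseteq> P i \<union> Q i" "map c (path_edges zs) = replicate (2 * m i) i"
      by blast
    have AB: "A \<inter> B = {}" and hcol: "\<And>a b. a \<in> A \<Longrightarrow> b \<in> B \<Longrightarrow> c {a, b} = h"
      using hub by (auto simp: biclique_def)
    have out: "set zs \<inter> (A \<union> B) = {}"
      using zs(5) insert.prems(4) by blast
    define U where "U = (\<Union>i\<in>I. P i \<union> Q i)"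
    have xsU: "set xs \<subseteq> A - {x, x'} \<union> (B - {b}) \<union> U"
      using xs(4) by (simp only: U_def)
    have "(P i \<union> Q i) \<inter> (P j \<union> Q j) = {}" if "j \<in> I" for j
      using insert.prems(5) insert.hyps(2) that by (metis insertCI)
    then have "(P i \<union> Q i) \<inter> U = {}"
      unfolding U_def by blast
    then have "set zs \<inter> set xs = {}"
      using zs(5) xsU out by blast
    moreover have "(A \<union> B) \<inter> U = {}"
      using insert.prems(4) unfolding U_def by blast
    then have "x \<notin> set xs" "x' \<notin> set xs" "b \<notin> set xs"
      using xsU x b AB by blast+
    moreover have "x \<noteq> b" "x' \<noteq> b" "x \<notin> set zs" "x' \<notin> set zs" "b \<notin> set zs"
      using x b AB out by blast+
    \<comment> \<open>The detour leaves the hub by \<open>{x, y}\<close>, zigzags from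
      \<open>y\<close> to \<open>y'\<close>, returns by \<open>{y', x'}\<close> and reaches the old
      path through \<open>b\<close>. The last two edges have color \<open>h\<close>, whence the
      summand \<open>card I\<close> for \<open>h\<close>.\<close>
    ultimately have "distinct (x # zs @ x' # b # xs)"
      using xs(2) zs(4) x(3) by auto
    moreover have "set (x # zs @ x' # b # xs) \<subseteq> A \<union> B \<union> (\<Union>i\<in>insert i I. P i \<union> Q i)"
      using x b zs(5) xsU by (auto simp: U_def)
    moreover have "map c (path_edges (x # zs @ x' # b # xs)) =
        c {x, y} # replicate (2 * m i) i @ c {x, y} # h # h # map c (path_edges xs)"
      using zs xs(1,3) x b hcol[of x' b] hcol[of "hd xs" b] eq
      by (simp add: path_edges_Cons path_edges_append insert_commute)
    moreover have "count_list (replicate (2 * m i) i) j = (if j = i then 2 * m i else 0)" for j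
      by (simp add: count_list_eq_length_filter)
    ultimately show ?thesis
      using x(1) cnt insert.hyps \<open>h \<noteq> i\<close>
      by (intro exI[of _ "x # zs @ x' # b # xs"]) (auto simp: e'_def)
  qed
  moreover have "e' j \<le> card (insert i I)" for j
    using e[of j] insert.hyps by (auto simp: e'_def)
  ultimately show ?case
    by blast
qed

section \<open>Disjoint bicliques in all colors\<close>

text \<open>The set \<open>X\<close> grows greedily. Each \<open>w\<close> in \<open>W'\<close>
  keeps at least \<delta> * \<open>card V\<close> neighbors outside \<open>X\<close>, because
  \<open>X\<close> uses up at most half of the guaranteed degree. By averaging, some new
  \<open>x\<close> is adjacent to a \<delta> fraction of \<open>W'\<close>, so each step costs a
  factor \<delta>.\<close>

lemma dense_graph_half_biclique:
  fixes E :: "'a set set" and \<delta> :: real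
  assumes "finite V" "W \<subseteq> V" "\<delta> > 0" "\<delta> \<le> 1"
    and deg: "\<And>w. w \<in> W \<Longrightarrow> card {v \<in> V. {w, v} \<in> E} \<ge> 2 * \<delta> * card V"
    and "real s \<le> \<delta> * card V"
  shows "\<exists>X W'. X \<subseteq> V \<and> card X = s \<and> W' \<subseteq> W \<and> card W' \<ge> \<delta> ^ s * card W \<and>
           (\<forall>w\<in>W'. \<forall>x\<in>X. {w, x} \<in> E)"
  using assms(6)
proof (induction s)
  case 0
  then show ?case by (intro exI[of _ "{}"] exI[of _ W]) auto
next
  case (Suc s)
  then obtain X W' where X: "X \<subseteq> V" "card X = s" and W': "W' \<subseteq> W"
    "card W' \<ge> \<delta> ^ s * card W" "\<forall>w\<in>W'. \<forall>x\<in>X. {w, x} \<in> E"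
    by auto
  have fin: "finite W'" "finite X" "finite (V - X)"
    using assms(1,2) X W' by (auto intro: finite_subset)
  let ?N = "\<lambda>x. {w \<in> W'. {w, x} \<in> E}"
  have "\<exists>x\<in>V - X. card (?N x) \<ge> \<delta> * card W'"
  proof (rule ccontr)
    assume neg: "\<not> ?thesis"
    \<comment> \<open>The comparison of sums below is strict only over a nonempty set. If
      \<open>X\<close> exhausted \<open>V\<close>, then \<open>card V\<close> would be at most
      \<open>s\<close>, contrary to \<open>Suc s\<close> being at most \<delta> *
      \<open>card V\<close>.\<close>
    have "V - X \<noteq> {}"
    proof
      assume "V - X = {}"
      then have "card V \<le> s" using X fin card_mono[of X V] by auto
      moreover have "\<delta> * card V \<le> card V"
        using assms(3,4) by (simp add: mult_left_le_one_le)
      ultimately show False using Suc.prems by linarith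
    qed
    have "\<delta> * card V * card W' \<le> (\<Sum>w\<in>W'. real (card {v \<in> V - X. {w, v} \<in> E}))"
    proof -
      have "\<delta> * card V \<le> card {v \<in> V - X. {w, v} \<in> E}" if "w \<in> W'" for w
      proof -
        have "{v \<in> V - X. {w, v} \<in> E} = {v \<in> V. {w, v} \<in> E} - X" by auto
        then have "card {v \<in> V. {w, v} \<in> E} \<le> card {v \<in> V - X. {w, v} \<in> E} + s"
          using diff_card_le_card_Diff[OF fin(2), of "{v \<in> V. {w, v} \<in> E}"] X(2) by auto
        then show ?thesis
          using deg[of w] that W'(1) Suc.prems by auto
      qed
      then show ?thesis
        using sum_bounded_below[of W' "\<delta> * card V"] by (simp add: mult.commute)
    qed
    also have "\<dots> = (\<Sum>x\<in>V - X. real (card (?N x)))"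
    proof -
      have "(\<Sum>w\<in>W'. card {v \<in> V - X. {w, v} \<in> E}) = (\<Sum>x\<in>V - X. card (?N x))"
        using sum_multicount_gen[OF fin(1,3), of "\<lambda>w v. {w, v} \<in> E" "\<lambda>x. card (?N x)"] by simp
      then show ?thesis by (simp only: flip: of_nat_sum)
    qed
    also have "\<dots> < (\<Sum>x\<in>V - X. \<delta> * card W')"
      using fin(3) \<open>V - X \<noteq> {}\<close> by (rule sum_strict_mono) (use neg in \<open>auto simp: not_le\<close>)
    also have "\<dots> = \<delta> * card (V - X) * card W'" by simp
    also have "\<dots> \<le> \<delta> * card V * card W'"
      using assms(1,3) by (intro mult_right_mono mult_left_mono) (auto intro: card_mono)
    finally show False by simp
  qed
  then obtain x where x: "x \<in> V - X" "card (?N x) \<ge> \<delta> * card W'" by blast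
  have "\<delta> ^ Suc s * card W \<le> \<delta> * card W'"
    using W'(2) assms(3) by simp
  then have "\<delta> ^ Suc s * card W \<le> card (?N x)"
    using x(2) by linarith
  then show ?case
    using x(1) X W' fin by (intro exI[of _ "insert x X"] exI[of _ "?N x"]) auto
qed

text \<open>The stars of all vertices cover \<open>E\<close>. Vertices of low degree contribute at
  most \<epsilon> * \<open>card V\<close> each, which is half of the required total; the rest comes
  from high-degree vertices, at most \<open>card V\<close> from each.\<close>

lemma dense_graph_high_degrees:
  fixes E :: "'a set set" and \<epsilon> :: real
  assumes "finite V" and E: "\<And>e. e \<in> E \<Longrightarrow> e \<subseteq> V \<and> card e = 2"
    and dense: "card E \<ge> 2 * \<epsilon> * (card V)\<^sup>2" and "\<epsilon> > 0"
  shows "card {w \<in> V. card {v \<in> V. {w, v} \<in> E} \<ge> \<epsilon> * card V} \<ge> \<epsilon> * card V"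
proof (cases "V = {}")
  case False
  let ?N = "\<lambda>w. {v \<in> V. {w, v} \<in> E}" and ?n = "real (card V)"
  let ?W = "{w \<in> V. card (?N w) \<ge> \<epsilon> * ?n}"
  have "E \<subseteq> (\<Union>w\<in>V. (\<lambda>v. {w, v}) ` ?N w)"
  proof
    fix e assume "e \<in> E"
    then obtain u v where "e = {u, v}" "u \<in> V" "v \<in> V" using E[of e] by (auto simp: card_2_iff)
    then show "e \<in> (\<Union>w\<in>V. (\<lambda>v. {w, v}) ` ?N w)" using \<open>e \<in> E\<close> by blast
  qed
  then have "card E \<le> card (\<Union>w\<in>V. (\<lambda>v. {w, v}) ` ?N w)"
    using assms(1) by (intro card_mono) auto
  also have "\<dots> \<le> (\<Sum>w\<in>V. card ((\<lambda>v. {w, v}) ` ?N w))"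
    using assms(1) by (rule card_UN_le)
  also have "\<dots> \<le> (\<Sum>w\<in>V. card (?N w))"
    using assms(1) by (intro sum_mono card_image_le) auto
  finally have "real (card E) \<le> (\<Sum>w\<in>V. real (card (?N w)))"
    by (simp only: of_nat_le_iff flip: of_nat_sum)
  also have "\<dots> \<le> (\<Sum>w\<in>V. \<epsilon> * ?n + (if w \<in> ?W then ?n else 0))"
    using assms(1,4) by (intro sum_mono) (auto intro!: card_mono add_increasing)
  also have "\<dots> = \<epsilon> * ?n\<^sup>2 + card ?W * ?n"
    using assms(1) by (simp add: sum.distrib sum.If_cases Int_def power2_eq_square)
  finally have "?n * (\<epsilon> * ?n) \<le> ?n * card ?W"
    using dense by (simp add: power2_eq_square algebra_simps)
  then show ?thesis
    using False assms(1) by (simp add: card_gt_0_iff)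
qed simp

text \<open>This is the qualitative Kovari-Sos-Turan theorem, obtained by running the greedy
  argument on the vertices of high degree.\<close>

lemma dense_graph_biclique:
  fixes \<epsilon> :: real
  assumes "\<epsilon> > 0"
  obtains N where "\<And>n E. n \<ge> N \<Longrightarrow> (\<And>e. e \<in> E \<Longrightarrow> e \<subseteq> {..<n} \<and> card e = 2) \<Longrightarrow>
    card E \<ge> \<epsilon> * (real n)\<^sup>2 \<Longrightarrow>
    \<exists>A B. A \<subseteq> {..<n} \<and> B \<subseteq> {..<n} \<and> card A = t \<and> card B = t \<and> (\<forall>a\<in>A. \<forall>b\<in>B. {a, b} \<in> E)"
proof -
  \<comment> \<open>The degree lemma is applied with 2 * \<delta>, which requires density 4 *
    \<delta> and yields the degrees 2 * \<delta> * \<open>n\<close> that the greedy argument starts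
    from.\<close>
  define \<delta> where "\<delta> = min 1 (\<epsilon> / 4)"
  have "\<delta> > 0" "\<delta> \<le> 1" "4 * \<delta> \<le> \<epsilon>" using assms by (auto simp: \<delta>_def)
  \<comment> \<open>The first summand makes room for the \<open>t\<close> greedy steps; the second
    ensures that the surviving set \<open>W'\<close> still has \<open>t\<close> elements.\<close>
  define N where "N = nat \<lceil>t / \<delta>\<rceil> + nat \<lceil>t / (\<delta> ^ t * (2 * \<delta>))\<rceil>"
  show thesis
  proof (rule that)
    fix n :: nat and E :: "nat set set"
    assume "n \<ge> N" and E: "\<And>e. e \<in> E \<Longrightarrow> e \<subseteq> {..<n} \<and> card e = 2"
      and dense: "card E \<ge> \<epsilon> * (real n)\<^sup>2"
    have "t / \<delta> \<le> n" "t / (\<delta> ^ t * (2 * \<delta>)) \<le> n"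
      using \<open>n \<ge> N\<close> unfolding N_def by linarith+
    then have n: "t \<le> \<delta> * n" "t \<le> \<delta> ^ t * (2 * \<delta>) * n"
      using \<open>\<delta> > 0\<close> by (simp_all add: divide_le_eq mult.commute)
    define W where "W = {w \<in> {..<n}. card {v \<in> {..<n}. {w, v} \<in> E} \<ge> 2 * \<delta> * n}"
    have "4 * \<delta> * (real n)\<^sup>2 \<le> card E"
      using dense mult_right_mono[OF \<open>4 * \<delta> \<le> \<epsilon>\<close>, of "(real n)\<^sup>2"] by simp
    then have W: "card W \<ge> 2 * \<delta> * n"
      using dense_graph_high_degrees[of "{..<n}" E "2 * \<delta>"] E \<open>\<delta> > 0\<close>
      by (simp add: W_def)
    have "W \<subseteq> {..<n}" and "\<And>w. w \<in> W \<Longrightarrow> card {v \<in> {..<n}. {w, v} \<in> E} \<ge> 2 * \<delta> * card {..<n}"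
      by (auto simp: W_def)
    then obtain X W' where X: "X \<subseteq> {..<n}" "card X = t" and W': "W' \<subseteq> W" "card W' \<ge> \<delta> ^ t * card W"
      "\<forall>w\<in>W'. \<forall>x\<in>X. {w, x} \<in> E"
      using dense_graph_half_biclique[of "{..<n}" W \<delta> E t] n(1) \<open>\<delta> > 0\<close> \<open>\<delta> \<le> 1\<close>
      by auto
    have "\<delta> ^ t * (2 * \<delta> * n) \<le> \<delta> ^ t * card W"
      using W \<open>\<delta> > 0\<close> by (intro mult_left_mono) auto
    then have "real t \<le> card W'"
      using n(2) W'(2) by (simp add: mult.assoc)
    then obtain A where "A \<subseteq> W'" "card A = t"
      by (meson obtain_subset_with_card_n of_nat_le_iff)
    then show "\<exists>A B. A \<subseteq> {..<n} \<and> B \<subseteq> {..<n} \<and> card A = t \<and> card B = t \<and>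
        (\<forall>a\<in>A. \<forall>b\<in>B. {a, b} \<in> E)"
      using X W' by (intro exI[of _ A] exI[of _ X]) (auto simp: W_def)
  qed
qed

lemma card_edges_meeting_le:
  assumes "finite V" "F \<subseteq> V"
  shows "card {e. e \<subseteq> V \<and> card e = 2 \<and> e \<inter> F \<noteq> {}} \<le> card F * card V"
proof -
  have "{e. e \<subseteq> V \<and> card e = 2 \<and> e \<inter> F \<noteq> {}} \<subseteq> (\<lambda>(u, v). {u, v}) ` (F \<times> V)"
  proof
    fix e assume "e \<in> {e. e \<subseteq> V \<and> card e = 2 \<and> e \<inter> F \<noteq> {}}"
    then obtain u v where "e = {u, v}" "u \<in> V" "v \<in> V" "u \<in> F \<or> v \<in> F"
      by (auto simp: card_2_iff)
    then show "e \<in> (\<lambda>(u, v). {u, v}) ` (F \<times> V)" by (auto simp: image_iff insert_commute)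
  qed
  moreover have "finite (F \<times> V)" using assms by (auto intro: finite_subset)
  ultimately have "card {e. e \<subseteq> V \<and> card e = 2 \<and> e \<inter> F \<noteq> {}} \<le> card (F \<times> V)"
    by (rule surj_card_le[rotated])
  then show ?thesis
    by (simp only: card_cartesian_product)
qed

text \<open>Colors are treated one after another. The vertices used so far number at most
  \<open>2 * t * r\<close>, so for large \<open>n\<close> they meet at most half of the \<epsilon> *
  \<open>n\<close>^2 edges guaranteed in the next color.\<close>

lemma disjoint_bicliques:
  fixes \<epsilon> :: real
  assumes "\<epsilon> > 0"
  obtains N where "\<And>n c. n \<ge> N \<Longrightarrow>
    \<forall>i<r. card (color_class (complete_graph n) c i) \<ge> \<epsilon> * (real n)\<^sup>2 \<Longrightarrow>
    \<exists>P Q. (\<forall>i<r. biclique c i t (P i) (Q i) \<and> P i \<union> Q i \<subseteq> {..<n}) \<and>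
      (\<forall>i<r. \<forall>j<r. i \<noteq> j \<longrightarrow> (P i \<union> Q i) \<inter> (P j \<union> Q j) = {})"
proof -
  obtain N where N: "\<And>n E. n \<ge> N \<Longrightarrow> (\<And>e. e \<in> E \<Longrightarrow> e \<subseteq> {..<n} \<and> card e = 2) \<Longrightarrow>
    card E \<ge> \<epsilon> / 2 * (real n)\<^sup>2 \<Longrightarrow>
    \<exists>A B. A \<subseteq> {..<n} \<and> B \<subseteq> {..<n} \<and> card A = t \<and> card B = t \<and> (\<forall>a\<in>A. \<forall>b\<in>B. {a, b} \<in> E)"
    using dense_graph_biclique[OF half_gt_zero[OF assms], of t] by blast
  show thesis
  proof (rule that)
    fix n :: nat and c :: "nat set \<Rightarrow> nat"
    assume "n \<ge> N + nat \<lceil>4 * t * r / \<epsilon>\<rceil>"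
      and dense: "\<forall>i<r. card (color_class (complete_graph n) c i) \<ge> \<epsilon> * (real n)\<^sup>2"
    then have "n \<ge> N" and "4 * t * r / \<epsilon> \<le> n" by linarith+
    then have n: "real (2 * t * r) \<le> \<epsilon> / 2 * n"
      using assms by (simp add: divide_le_eq mult.commute)
    \<comment> \<open>The induction also records exact side sizes, since \<open>biclique\<close>
      alone gives no upper bound on the number of used vertices.\<close>
    have "\<exists>P Q. (\<forall>i<s. biclique c i t (P i) (Q i) \<and> card (P i) = t \<and> card (Q i) = t \<and>
          P i \<union> Q i \<subseteq> {..<n}) \<and>
        (\<forall>i<s. \<forall>j<s. i \<noteq> j \<longrightarrow> (P i \<union> Q i) \<inter> (P j \<union> Q j) = {})" if "s \<le> r" for s
      using that
    proof (induction s)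
      case (Suc s)
      from Suc.IH[OF Suc_leD[OF Suc.prems]] obtain P Q where
        PQ: "\<forall>i<s. biclique c i t (P i) (Q i) \<and> card (P i) = t \<and> card (Q i) = t \<and>
          P i \<union> Q i \<subseteq> {..<n}"
        and disj: "\<forall>i<s. \<forall>j<s. i \<noteq> j \<longrightarrow> (P i \<union> Q i) \<inter> (P j \<union> Q j) = {}"
        by (elim exE conjE)
      define F where "F = (\<Union>i<s. P i \<union> Q i)"
      have F: "F \<subseteq> {..<n}" using PQ by (force simp: F_def)
      have "card F \<le> (\<Sum>i<s. card (P i \<union> Q i))"
        unfolding F_def by (rule card_UN_le) simp
      also have "\<dots> \<le> (\<Sum>i<s. 2 * t)"
      proof (rule sum_mono)
        fix i assume "i \<in> {..<s}"
        then show "card (P i \<union> Q i) \<le> 2 * t"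
          using card_Un_le[of "P i" "Q i"] PQ by simp
      qed
      also have "\<dots> \<le> 2 * t * r" using Suc.prems by simp
      finally have cF: "card F \<le> 2 * t * r" .
      define M where "M = {e. e \<subseteq> {..<n} \<and> card e = 2 \<and> e \<inter> F \<noteq> {}}"
      define E where "E = color_class (complete_graph n) c s - M"
      have "finite M" by (rule finite_subset[of _ "Pow {..<n}"]) (auto simp: M_def)
      have "real (card M) \<le> real (card F) * n"
        using card_edges_meeting_le[OF _ F] by (simp add: M_def flip: of_nat_mult)
      also have "\<dots> \<le> \<epsilon> / 2 * n * n"
        using cF n by (intro mult_right_mono) linarith+
      finally have "real (card M) \<le> \<epsilon> / 2 * (real n)\<^sup>2"
        by (simp add: power2_eq_square)
      moreover have "real (card (color_class (complete_graph n) c s)) \<le> card E + card M"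
        using diff_card_le_card_Diff[OF \<open>finite M\<close>, of "color_class (complete_graph n) c s"]
        unfolding E_def by linarith
      ultimately have "card E \<ge> \<epsilon> / 2 * (real n)\<^sup>2"
        using dense[rule_format, of s] Suc.prems by simp
      moreover have E: "e \<subseteq> {..<n}" "card e = 2" "c e = s" "e \<inter> F = {}" if "e \<in> E" for e
        using that by (auto simp: E_def M_def color_class_def complete_graph_def)
      ultimately have "\<exists>A B. A \<subseteq> {..<n} \<and> B \<subseteq> {..<n} \<and> card A = t \<and> card B = t \<and>
          (\<forall>a\<in>A. \<forall>b\<in>B. {a, b} \<in> E)"
        by (intro N[OF \<open>n \<ge> N\<close>] conjI)
      then obtain A B where AB: "A \<subseteq> {..<n}" "B \<subseteq> {..<n}" "card A = t" "card B = t"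
        "\<And>a b. a \<in> A \<Longrightarrow> b \<in> B \<Longrightarrow> {a, b} \<in> E"
        by blast
      show ?case
      \<comment> \<open>Avoidance of \<open>F\<close> is read off from edges of \<open>E\<close>
        between \<open>A\<close> and \<open>B\<close>, so it reaches every vertex only if both sides
        are nonempty.\<close>
      proof (cases "t = 0")
        case True
        then show ?thesis
          by (intro exI[of _ "\<lambda>_. {}"]) (auto simp: biclique_def)
      next
        case False
        then have ne: "A \<noteq> {}" "B \<noteq> {}" using AB by auto
        \<comment> \<open>A common vertex would put a singleton into \<open>E\<close>.\<close>
        have "A \<inter> B = {}" using AB(5) E(2) by fastforce
        moreover have fin: "finite A" "finite B" using AB by (auto intro: finite_subset)
        ultimately have "biclique c s t A B"
          using AB E(3) by (auto simp: biclique_def)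
        moreover have "(A \<union> B) \<inter> F = {}" using AB(5) E(4) ne by fast
        then have "(A \<union> B) \<inter> (P i \<union> Q i) = {}" if "i < s" for i
          using that by (auto simp: F_def)
        ultimately show ?thesis
          using PQ disj AB(1-4)
          by (intro exI[of _ "P(s := A)"] exI[of _ "Q(s := B)"]) (auto simp: less_Suc_eq)
      qed
    qed simp
    from this[OF order_refl] show "\<exists>P Q. (\<forall>i<r. biclique c i t (P i) (Q i) \<and> P i \<union> Q i \<subseteq> {..<n}) \<and>
        (\<forall>i<r. \<forall>j<r. i \<noteq> j \<longrightarrow> (P i \<union> Q i) \<inter> (P j \<union> Q j) = {})"
      by blast
  qed
qed

section \<open>The balancing number of paths\<close>

lemma dense_coloring_contains_balanced_path:
  fixes \<epsilon> :: real
  assumes "\<epsilon> > 0" "r > 0" "k \<ge> 2 * r"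
  obtains N where "\<And>n c. n \<ge> N \<Longrightarrow> edge_coloring r (complete_graph n) c \<Longrightarrow>
    \<forall>i<r. card (color_class (complete_graph n) c i) \<ge> \<epsilon> * (real n)\<^sup>2 \<Longrightarrow>
    contains_balanced_copy r (complete_graph n) c (path_graph (2 * r * k))"
proof -
  \<comment> \<open>Color 0 is the hub. One size \<open>?t\<close> serves all colors: it is large
    enough for a hub with \<open>r - 1\<close> detours, and the other bicliques may be larger than
    needed.\<close>
  let ?t = "2 * r + Suc (r + k)" and ?I = "{1..<r}"
  obtain N where N: "\<And>n c. n \<ge> N \<Longrightarrow>
    \<forall>i<r. card (color_class (complete_graph n) c i) \<ge> \<epsilon> * (real n)\<^sup>2 \<Longrightarrow>
    \<exists>P Q. (\<forall>i<r. biclique c i ?t (P i) (Q i) \<and> P i \<union> Q i \<subseteq> {..<n}) \<and>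
      (\<forall>i<r. \<forall>j<r. i \<noteq> j \<longrightarrow> (P i \<union> Q i) \<inter> (P j \<union> Q j) = {})"
    using disjoint_bicliques[OF assms(1), of r ?t] by blast
  show thesis
  proof (rule that)
    fix n :: nat and c
    assume "n \<ge> N" and "edge_coloring r (complete_graph n) c"
      and dense: "\<forall>i<r. card (color_class (complete_graph n) c i) \<ge> \<epsilon> * (real n)\<^sup>2"
    then have col: "c {u, v} < r" if "u < n" "v < n" "u \<noteq> v" for u v
      using that by (simp add: edge_coloring_def complete_graph_def)
    from N[OF \<open>n \<ge> N\<close> dense] obtain P Q where
      PQ: "\<forall>i<r. biclique c i ?t (P i) (Q i) \<and> P i \<union> Q i \<subseteq> {..<n}"
        "\<forall>i<r. \<forall>j<r. i \<noteq> j \<longrightarrow> (P i \<union> Q i) \<inter> (P j \<union> Q j) = {}"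
      by (elim exE conjE)
    have bi: "biclique c i ?t (P i) (Q i)" and sub: "P i \<union> Q i \<subseteq> {..<n}" if "i < r" for i
      using PQ(1) that by simp_all
    have disj: "(P i \<union> Q i) \<inter> (P j \<union> Q j) = {}" if "i < r" "j < r" "i \<noteq> j" for i j
      using PQ(2) that by simp
    have "\<exists>e. (\<forall>j. e j \<le> card ?I) \<and>
      (\<forall>m. (\<forall>j. 1 \<le> m j \<and> m j \<le> k) \<longrightarrow>
        (\<exists>xs. xs \<noteq> [] \<and> distinct xs \<and> hd xs \<in> P 0 \<and>
          set xs \<subseteq> P 0 \<union> Q 0 \<union> (\<Union>i\<in>?I. P i \<union> Q i) \<and>
          (\<forall>j. count_list (map c (path_edges xs)) j =
            2 * (e j + (if j \<in> insert 0 ?I then m j else 0) + (if j = 0 then card ?I else 0)))))"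
    proof (rule hub_path)
      show "biclique c 0 (2 * card ?I + Suc (r + k)) (P 0) (Q 0)"
        using bi[of 0] \<open>r > 0\<close> by (auto intro: biclique_mono)
      show "\<forall>i\<in>?I. biclique c i (Suc (r + k)) (P i) (Q i)"
        by (auto intro!: biclique_mono[OF bi])
      show "\<forall>i\<in>?I. (P i \<union> Q i) \<inter> (P 0 \<union> Q 0) = {}"
        using disj \<open>r > 0\<close> by (metis atLeastLessThan_iff not_one_le_zero)
      show "\<forall>i\<in>?I. \<forall>j\<in>?I. i \<noteq> j \<longrightarrow> (P i \<union> Q i) \<inter> (P j \<union> Q j) = {}"
        using disj by simp
      show "\<forall>i\<in>?I. \<forall>x\<in>P 0. \<forall>y\<in>P i. c {x, y} < r"
      proof (intro ballI)
        fix i x y assume "i \<in> ?I" "x \<in> P 0" "y \<in> P i"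
        then show "c {x, y} < r"
          using sub[of 0] sub[of i] disj[of 0 i] by (intro col) auto
      qed
    qed auto
    then obtain e where e: "\<forall>j. e j \<le> card ?I" and
      path: "\<forall>m. (\<forall>j. 1 \<le> m j \<and> m j \<le> k) \<longrightarrow>
        (\<exists>xs. xs \<noteq> [] \<and> distinct xs \<and> hd xs \<in> P 0 \<and>
          set xs \<subseteq> P 0 \<union> Q 0 \<union> (\<Union>i\<in>?I. P i \<union> Q i) \<and>
          (\<forall>j. count_list (map c (path_edges xs)) j =
            2 * (e j + (if j \<in> insert 0 ?I then m j else 0) + (if j = 0 then card ?I else 0))))"
      by (elim exE conjE)
    \<comment> \<open>The zigzags fill each color up to \<open>k\<close> pairs. The forced pairs
      number at most \<open>r - 1\<close> from connecting edges and, for the hub,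
      \<open>r - 1\<close> more; thus \<open>k \<ge> 2 * r\<close> keeps the subtraction exact and
      \<open>m j\<close> positive.\<close>
    define m where "m j = k - e j - (if j = 0 then card ?I else 0)" for j :: nat
    have m: "1 \<le> m j" "e j + m j + (if j = 0 then card ?I else 0) = k" for j
      using e[rule_format, of j] assms(2,3) by (auto simp: m_def)
    have "m j \<le> k" for j
      by (simp add: m_def)
    with m(1) have "\<forall>j. 1 \<le> m j \<and> m j \<le> k"
      by blast
    from path[THEN spec, THEN mp, OF this] obtain xs where xs: "xs \<noteq> []" "distinct xs"
      "set xs \<subseteq> P 0 \<union> Q 0 \<union> (\<Union>i\<in>?I. P i \<union> Q i)"
      "\<forall>j. count_list (map c (path_edges xs)) j =
          2 * (e j + (if j \<in> insert 0 ?I then m j else 0) + (if j = 0 then card ?I else 0))"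
      by (elim exE conjE)
    have cnt: "count_list (map c (path_edges xs)) j = 2 * k" if "j < r" for j
      using xs(4)[rule_format, of j] m(2)[of j] that by (cases "j = 0") auto
    have "P 0 \<union> Q 0 \<union> (\<Union>i\<in>?I. P i \<union> Q i) \<subseteq> {..<n}"
      using sub \<open>r > 0\<close> by fastforce
    with xs(3) have "set xs \<subseteq> {..<n}" by blast
    from contains_balanced_copy_path_graph[OF xs(2) this \<open>r > 0\<close> col cnt xs(1)]
    show "contains_balanced_copy r (complete_graph n) c (path_graph (2 * r * k))"
      by (simp add: mult.left_commute mult.commute)
  qed
qed

text \<open>No color class exceeds the whole edge set. Hence \<open>bal\<close> is finite, and
  \<open>the_enat\<close> in the main result yields its actual value.\<close>

lemma forces_balanced_copy_vacuous:
  assumes "r > 0"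
  shows "forces_balanced_copy r n G (card (edges (complete_graph n)))"
proof -
  have "finite (edges (complete_graph n))"
    by (rule finite_subset[of _ "Pow {..<n}"]) (auto simp: complete_graph_def)
  then have "card (color_class (complete_graph n) c 0) \<le> card (edges (complete_graph n))" for c
    by (rule card_mono) (auto simp: color_class_def)
  then show ?thesis
    using assms unfolding forces_balanced_copy_def by (meson leD)
qed

lemma bal_ne_infinity: "r > 0 \<Longrightarrow> bal r n G \<noteq> \<infinity>"
  using forces_balanced_copy_vacuous[of r n G] by (auto simp: bal_def)

lemma the_enat_bal_le: "forces_balanced_copy r n G m \<Longrightarrow> the_enat (bal r n G) \<le> m"
  by (auto simp: bal_def intro: Least_le)

theorem theorem1p9:
  fixes r :: nat
  assumes "r \<ge> 2"
  shows "\<exists>k0. \<forall>k\<ge>k0.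
           (\<forall>\<^sub>F n in sequentially. bal r n (path_graph (2 * r * k)) \<noteq> \<infinity>) \<and>
           (\<lambda>n. real (the_enat (bal r n (path_graph (2 * r * k))))) \<in> o(\<lambda>n. (real n)\<^sup>2)"
proof (intro exI[of _ "2 * r"] allI impI conjI)
  fix k assume k: "k \<ge> 2 * r"
  have "r > 0" using assms by simp
  then show "\<forall>\<^sub>F n in sequentially. bal r n (path_graph (2 * r * k)) \<noteq> \<infinity>"
    by (simp add: bal_ne_infinity)
  show "(\<lambda>n. real (the_enat (bal r n (path_graph (2 * r * k))))) \<in> o(\<lambda>n. (real n)\<^sup>2)"
  proof (rule landau_o.smallI)
    fix \<epsilon> :: real assume "\<epsilon> > 0"
    then obtain N where N: "\<And>n c. n \<ge> N \<Longrightarrow> edge_coloring r (complete_graph n) c \<Longrightarrow>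
      \<forall>i<r. card (color_class (complete_graph n) c i) \<ge> \<epsilon> * (real n)\<^sup>2 \<Longrightarrow>
      contains_balanced_copy r (complete_graph n) c (path_graph (2 * r * k))"
      using dense_coloring_contains_balanced_path[OF _ \<open>r > 0\<close> k] by blast
    have "real (the_enat (bal r n (path_graph (2 * r * k)))) \<le> \<epsilon> * (real n)\<^sup>2" if "n \<ge> N" for n
    proof -
      \<comment> \<open>Class sizes are integers, so exceeding the rounded-down \<open>?m\<close>
        already means having at least \<epsilon> * \<open>n\<close>^2 edges.\<close>
      let ?m = "nat \<lfloor>\<epsilon> * (real n)\<^sup>2\<rfloor>"
      have "\<epsilon> * (real n)\<^sup>2 \<le> real s" if "s > ?m" for s
        using that by linarith
      then have "forces_balanced_copy r n (path_graph (2 * r * k)) ?m"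
        using N[OF that] unfolding forces_balanced_copy_def by blast
      then have "the_enat (bal r n (path_graph (2 * r * k))) \<le> ?m"
        by (rule the_enat_bal_le)
      moreover have "real ?m \<le> \<epsilon> * (real n)\<^sup>2"
        using \<open>\<epsilon> > 0\<close> by simp
      ultimately show ?thesis by linarith
    qed
    then show "\<forall>\<^sub>F n in sequentially.
        norm (real (the_enat (bal r n (path_graph (2 * r * k))))) \<le> \<epsilon> * norm ((real n)\<^sup>2)"
      by (intro eventually_sequentiallyI[of N]) simp
  qed
qed

end
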